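(* Let $A,B\in\mathbb{Q}$ with $AB\neq 0$. (1) If $x^6+Ax^3+B$ has reducibility type $(2,2,2)$, then up to scaling $$A=-27u(u+1),\qquad B=27(u^2+u+1)^3$$ for some $u\in\mathbb{Q}$, $u\neq0,-1,-\tfrac12$, with $$x^6-27u(u+1)x^3+27(u^2+u+1)^3=\bigl(x^2+3x+3(u^2+u+1)\bigr)\bigl(x^2-3(u+1)x+3(u^2+u+1)\bigr)\bigl(x^2+3ux+3(u^2+u+1)\bigr).$$ (2) If $x^6+Ax^3+B$ has reducibility type $(1,1,2,2)$, then up to scaling $A=-u^3-1$, $B=u^3$ for some $u\in\mathbb{Q}$, $u\neq0,-1$, and $$x^6+Ax^3+B=(x-1)(x-u)(x^2+x+1)(x^2+ux+u^2).$$ (3) There are no trinomials $x^6+Ax^3+B$ of reducibility type $(1,1,1,1,2)$. (4) If $x^6+Ax^3+B$ has reducibility type $(1,2,3)$, then up to scaling $(A,B)=(t-1,-t)$ for some $t\in\mathbb{Q}$ that is not the cube of a rational number, and $$x^6+(t-1)x^3-t=(x-1)(x^2+x+1)(x^3+t).$$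
   Context: A monic polynomial in $\mathbb{Q}[x]$ has reducibility type $(n_1,\dots,n_k)$, $n_1\le\dots\le n_k$, if it factors as a product of $k$ irreducible polynomials in $\mathbb{Q}[x]$ (not necessarily distinct) of degrees $n_1,\dots,n_k$. Trinomials are considered up to scaling: $x^n+Ax^m+B$ and $x^n+A\lambda^{n-m}x^m+B\lambda^n$ are identified for $\lambda\in\mathbb{Q}\setminus\{0\}$; "up to scaling $(A,B)=(A_0,B_0)$" means $(A,B)=(A_0\lambda^{n-m},B_0\lambda^n)$ for some $\lambda\in\mathbb{Q}\setminus\{0\}$ (and the factorization is that of the scaled trinomial). *)

theory Defs
  imports "HOL-Computational_Algebra.Polynomial_Factorial"
begin

definition trinomial :: "nat \<Rightarrow> nat \<Rightarrow> rat \<Rightarrow> rat \<Rightarrow> rat poly" where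
  "trinomial n m A B = monom 1 n + monom A m + [:B:]"

text \<open>The irreducible factors need not be distinct, and need not be monic.\<close>

definition has_reducibility_type :: "rat poly \<Rightarrow> nat list \<Rightarrow> bool" where
  "has_reducibility_type p ns \<longleftrightarrow> lead_coeff p = 1 \<and> sorted ns \<and>
     (\<exists>fs. p = prod_list fs \<and> (\<forall>f \<in> set fs. irreducible f) \<and> map degree fs = ns)"

text \<open>Substituting \<open>x / c\<close> for \<open>x\<close> in the trinomial with coefficients \<open>(A\<^sub>0, B\<^sub>0)\<close> and multiplying
  by \<open>c ^ n\<close> gives the trinomial with coefficients \<open>(A, B)\<close>; here \<open>m \<le> n\<close> is intended.\<close>

fun equal_up_to_scaling :: "nat \<Rightarrow> nat \<Rightarrow> rat \<times> rat \<Rightarrow> rat \<times> rat \<Rightarrow> bool" where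
  "equal_up_to_scaling n m (A, B) (A\<^sub>0, B\<^sub>0) \<longleftrightarrow>
     (\<exists>c. c \<noteq> 0 \<and> A = A\<^sub>0 * c ^ (n - m) \<and> B = B\<^sub>0 * c ^ n)"

end

theory Submission
  imports Defs
begin

text \<open>
  A monic quadratic \<open>x\<^sup>2 + a x + b\<close> dividing \<open>x\<^sup>6 + A x\<^sup>3 + B\<close> either divides \<open>x\<^sup>3 - a\<^sup>3\<close>,
  and then \<open>a\<close> is a root of the trinomial, or the class of \<open>x\<^sup>3\<close> modulo the quadratic is not
  rational, and then \<open>y\<^sup>2 + A y + B\<close> is its minimal polynomial, so that taking the norm gives
  \<open>B = b\<^sup>3\<close>. In type \<open>(2,2,2)\<close> all constant terms therefore agree, and comparing the coefficients
  of \<open>x\<^sup>5\<close> and \<open>x\<^sup>4\<close> finishes the parametrisation.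
  In the other types a rational root \<open>\<alpha>\<close> gives the factorization
  \<open>(x - \<alpha>)(x\<^sup>2 + \<alpha> x + \<alpha>\<^sup>2)(x\<^sup>3 - \<gamma>)\<close>, whose quadratic factor has no rational root, so that
  any further rational root is a cube root of \<open>\<gamma>\<close>.
\<close>

lemma trinomial_6_3: "trinomial 6 3 A B = [:B, 0, 0, A, 0, 0, 1:]"
  unfolding trinomial_def by (simp add: eval_nat_numeral monom_Suc monom_0)

text \<open>Twice the form is a sum of three squares, so it is definite. This is why
  \<open>x^2 + \<alpha> x + \<alpha>^2\<close> has no rational root when \<open>\<alpha>\<close> is
  nonzero.\<close>

lemma sum_squares_mixed_eq_0_iff:
  fixes x y :: rat
  shows "x\<^sup>2 + x * y + y\<^sup>2 = 0 \<longleftrightarrow> x = 0 \<and> y = 0"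
proof
  assume h: "x\<^sup>2 + x * y + y\<^sup>2 = 0"
  have "x\<^sup>2 + y\<^sup>2 + (x + y)\<^sup>2 = 2 * (x\<^sup>2 + x * y + y\<^sup>2)"
    by (simp add: power2_eq_square algebra_simps)
  with h have "x\<^sup>2 + y\<^sup>2 + (x + y)\<^sup>2 = 0" by simp
  then show "x = 0 \<and> y = 0"
    by (metis add_nonneg_eq_0_iff sum_power2_eq_zero_iff sum_power2_ge_zero zero_le_power2)
qed simp

lemma cube_eq_iff:
  fixes x y :: rat
  shows "x ^ 3 = y ^ 3 \<longleftrightarrow> x = y"
proof
  assume "x ^ 3 = y ^ 3"
  moreover have "x ^ 3 - y ^ 3 = (x - y) * (x\<^sup>2 + x * y + y\<^sup>2)"
    by (simp add: eval_nat_numeral algebra_simps)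
  ultimately have "x = y \<or> x\<^sup>2 + x * y + y\<^sup>2 = 0" by simp
  then show "x = y" by (auto simp: sum_squares_mixed_eq_0_iff)
qed simp

section \<open>Roots and factors of low degree over a field\<close>

lemma irreducible_imp_no_root:
  fixes p :: "'a :: field poly"
  assumes "irreducible p" "degree p \<ge> 2"
  shows "poly p x \<noteq> 0"
proof
  assume "poly p x = 0"
  then obtain q where q: "p = [:- x, 1:] * q"
    by (auto simp: poly_eq_0_iff_dvd)
  moreover have "\<not> [:- x, 1:] dvd 1"
    by (simp add: is_unit_iff_degree)
  ultimately have "q dvd 1"
    using assms(1) irreducibleD by blast
  then have "degree q = 0" "q \<noteq> 0"
    by (metis is_unit_iff_degree not_is_unit_0)+
  then have "degree p = 1" unfolding q by (subst degree_mult_eq) auto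
  with assms(2) show False by simp
qed

lemma degree_1_root:
  fixes p :: "'a :: field poly"
  assumes "degree p = 1"
  obtains a k where "k \<noteq> 0" "p = smult k [:- a, 1:]"
proof -
  from assms obtain b c where p: "p = [:b, c:]" "c \<noteq> 0"
    by (metis degree1_coeffs)
  then have "p = smult c [:- (- b / c), 1:]" by simp
  with p(2) show thesis by (rule that)
qed

lemma degree_2_monic_multiple:
  fixes p :: "'a :: field poly"
  assumes "degree p = 2"
  obtains a b where "p = smult (lead_coeff p) [:b, a, 1:]"
proof -
  from assms obtain r q s where p: "p = [:r, q, s:]" "s \<noteq> 0"
    by (metis degree2_coeffs)
  then have "p = smult (lead_coeff p) [:r / s, q / s, 1:]" by simp
  then show thesis by (rule that)
qed

section \<open>Quadratic divisors of a trinomial without rational roots\<close>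

lemma quadratic_dvd_trinomial:
  assumes dvd: "[:b, a, 1:] dvd trinomial 6 3 A B"
    and no_root: "\<And>x. poly (trinomial 6 3 A B) x \<noteq> 0"
  shows "B = b ^ 3"
proof -
  \<comment> \<open>Modulo \<open>q\<close>, \<open>x^3\<close> is congruent to
    \<open>p x + r\<close>; more precisely \<open>x^3 = q (x - a) + (p x + r)\<close>.\<close>
  define p r where "p = a\<^sup>2 - b" and "r = a * b"
  define q where "q = [:b, a, 1:]"
  \<comment> \<open>Quotient and remainder of the division by \<open>q\<close>: write
    \<open>x^6 = (x^3 - L)(x^3 + L) + L^2\<close> with \<open>L = p x + r\<close>, then reduce
    \<open>L^2\<close> once more, which contributes the quotient \<open>p^2\<close>.\<close>
  define w where "w = [:- a, 1:] * [:r, p, 0, 1:] + [:p\<^sup>2:] + smult A [:- a, 1:]"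
  define s where "s = [:r\<^sup>2 - b * p\<^sup>2 + A * r + B, p * (2 * r - a * p + A):]"
  have split: "trinomial 6 3 A B = q * w + s"
    unfolding trinomial_6_3 q_def w_def s_def p_def r_def
    by (simp add: eval_nat_numeral algebra_simps)
  have "q dvd s"
    using dvd split unfolding q_def by (metis dvd_add_right_iff dvd_triv_left)
  moreover have "degree s < degree q" unfolding s_def q_def by simp
  ultimately have "s = 0" by (metis dvd_imp_degree_le leD)
  then have 1: "p * (2 * r - a * p + A) = 0" and 0: "r\<^sup>2 - b * p\<^sup>2 + A * r + B = 0"
    unfolding s_def by simp_all
  \<comment> \<open>If \<open>p = 0\<close>, then \<open>b = a^2\<close> and \<open>x^3\<close> is
    congruent to the constant \<open>a^3\<close>, so the constant remainder is the value of the
    trinomial at \<open>a\<close>.\<close>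
  have "p \<noteq> 0"
  proof
    assume "p = 0"
    then have "r = a ^ 3" unfolding p_def r_def by (simp add: eval_nat_numeral)
    with 0 \<open>p = 0\<close> have "poly (trinomial 6 3 A B) a = 0"
      unfolding trinomial_6_3 by (simp add: eval_nat_numeral algebra_simps)
    with no_root show False by blast
  qed
  with 1 have A: "A = a * p - 2 * r" by simp
  \<comment> \<open>With this \<open>A\<close>, the constant remainder gives
    \<open>B = r^2 - a p r + b p^2\<close>, the norm of \<open>p x + r\<close>, hence of
    \<open>x^3\<close>; the norm of \<open>x\<close> is \<open>b\<close>.\<close>
  show "B = b ^ 3"
    using 0 unfolding A p_def r_def by (simp add: eval_nat_numeral algebra_simps)
qed

section \<open>Splitting off rational roots\<close>

lemma cancel_linear:
  fixes g h :: "'a :: field poly"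
  assumes "k \<noteq> 0" "smult k [:- a, 1:] * g = [:- a, 1:] * h"
  shows "h = smult k g"
proof -
  have "[:- a, 1:] * smult k g = [:- a, 1:] * h"
    using assms(2) by (metis mult_smult_left mult_smult_right)
  then show ?thesis by (metis mult_left_cancel one_neq_zero pCons_eq_0_iff)
qed

lemma trinomial_linear_factor:
  assumes "trinomial 6 3 A B = f * g" "degree f = 1" "B \<noteq> 0"
  obtains \<alpha> \<gamma> k where "\<alpha> \<noteq> 0" "k \<noteq> 0" "A = - (\<alpha> ^ 3 + \<gamma>)" "B = \<alpha> ^ 3 * \<gamma>"
    "[:\<alpha>\<^sup>2, \<alpha>, 1:] * [:- \<gamma>, 0, 0, 1:] = smult k g"
proof -
  from assms(2) obtain \<alpha> k where f: "k \<noteq> 0" "f = smult k [:- \<alpha>, 1:]"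
    by (rule degree_1_root)
  \<comment> \<open>The roots of \<open>y^2 + A y + B\<close> sum to \<open>-A\<close> and one of
    them is \<open>\<alpha>^3\<close>, so this is the other.\<close>
  define \<gamma> where "\<gamma> = - A - \<alpha> ^ 3"
  have "poly (trinomial 6 3 A B) \<alpha> = 0" unfolding assms(1) f by simp
  then have B: "B = \<alpha> ^ 3 * \<gamma>"
    unfolding trinomial_6_3 \<gamma>_def by (simp add: eval_nat_numeral algebra_simps add_eq_0_iff)
  have A: "A = - (\<alpha> ^ 3 + \<gamma>)" by (simp add: \<gamma>_def)
  have "trinomial 6 3 A B = [:- \<alpha>, 1:] * ([:\<alpha>\<^sup>2, \<alpha>, 1:] * [:- \<gamma>, 0, 0, 1:])"
    unfolding trinomial_6_3 A B by (simp add: eval_nat_numeral algebra_simps)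
  then have "smult k [:- \<alpha>, 1:] * g = [:- \<alpha>, 1:] * ([:\<alpha>\<^sup>2, \<alpha>, 1:] * [:- \<gamma>, 0, 0, 1:])"
    unfolding assms(1) f(2) .
  then have "[:\<alpha>\<^sup>2, \<alpha>, 1:] * [:- \<gamma>, 0, 0, 1:] = smult k g"
    by (rule cancel_linear[OF f(1)])
  moreover have "\<alpha> \<noteq> 0" using B assms(3) by auto
  ultimately show thesis using that f(1) A B by blast
qed

text \<open>The root \<open>\<beta>\<close> of the second linear factor cannot come from the
  definite quadratic, so it satisfies \<open>\<beta>^3 = \<gamma>\<close>, and
  \<open>x^3 - \<gamma>\<close> splits as well. The scalar \<open>k\<close> absorbs the leading
  coefficients, since the factors need not be monic.\<close>

lemma trinomial_two_linear_factors:
  assumes "trinomial 6 3 A B = f * (g * h)" "degree f = 1" "degree g = 1" "B \<noteq> 0"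
  obtains \<alpha> \<beta> k where "\<alpha> \<noteq> 0" "\<beta> \<noteq> 0" "k \<noteq> 0" "A = - (\<alpha> ^ 3 + \<beta> ^ 3)" "B = \<alpha> ^ 3 * \<beta> ^ 3"
    "[:\<alpha>\<^sup>2, \<alpha>, 1:] * [:\<beta>\<^sup>2, \<beta>, 1:] = smult k h"
proof -
  from assms obtain \<alpha> \<gamma> k where *: "\<alpha> \<noteq> 0" "k \<noteq> 0" "A = - (\<alpha> ^ 3 + \<gamma>)" "B = \<alpha> ^ 3 * \<gamma>"
    "[:\<alpha>\<^sup>2, \<alpha>, 1:] * [:- \<gamma>, 0, 0, 1:] = smult k (g * h)"
    by (elim trinomial_linear_factor)
  from assms(3) obtain \<beta> l where g: "l \<noteq> 0" "g = smult l [:- \<beta>, 1:]"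
    by (rule degree_1_root)
  have "poly ([:\<alpha>\<^sup>2, \<alpha>, 1:] * [:- \<gamma>, 0, 0, 1:]) \<beta> = 0" unfolding *(5) g by simp
  moreover have "poly ([:\<alpha>\<^sup>2, \<alpha>, 1:] * [:- \<gamma>, 0, 0, 1:]) \<beta>
      = (\<beta>\<^sup>2 + \<beta> * \<alpha> + \<alpha>\<^sup>2) * (\<beta> ^ 3 - \<gamma>)"
    by (simp add: eval_nat_numeral algebra_simps)
  moreover have "\<beta>\<^sup>2 + \<beta> * \<alpha> + \<alpha>\<^sup>2 \<noteq> 0" using *(1) by (simp add: sum_squares_mixed_eq_0_iff)
  ultimately have \<gamma>: "\<gamma> = \<beta> ^ 3" by simp
  have "[:- \<beta>, 1:] * ([:\<alpha>\<^sup>2, \<alpha>, 1:] * [:\<beta>\<^sup>2, \<beta>, 1:]) = [:\<alpha>\<^sup>2, \<alpha>, 1:] * [:- \<gamma>, 0, 0, 1:]"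
    unfolding \<gamma> by (simp add: eval_nat_numeral algebra_simps)
  also have "\<dots> = smult (k * l) [:- \<beta>, 1:] * h"
    unfolding *(5) g by (simp only: mult_smult_left mult_smult_right smult_smult)
  finally have "[:\<alpha>\<^sup>2, \<alpha>, 1:] * [:\<beta>\<^sup>2, \<beta>, 1:] = smult (k * l) h"
    using *(2) g(1) by (intro cancel_linear[of "k * l" \<beta>]) simp_all
  moreover have "\<beta> \<noteq> 0" using *(4) \<gamma> assms(4) by auto
  ultimately show thesis using that[of \<alpha> \<beta> "k * l"] * g(1) \<gamma> by simp
qed

section \<open>The individual reducibility types\<close>

lemma type_2_2_2:
  assumes "A \<noteq> 0" "has_reducibility_type (trinomial 6 3 A B) [2, 2, 2]"
  obtains u c where "u \<noteq> 0" "u \<noteq> -1" "u \<noteq> -1/2" "c \<noteq> 0"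
    "A = -27 * u * (u + 1) * c ^ 3" "B = 27 * (u\<^sup>2 + u + 1) ^ 3 * c ^ 6"
proof -
  define f where "f = trinomial 6 3 A B"
  from assms(2) obtain f1 f2 f3 where f: "f = f1 * f2 * f3"
    and irr: "irreducible f1" "irreducible f2" "irreducible f3"
    and deg: "degree f1 = 2" "degree f2 = 2" "degree f3 = 2"
    unfolding has_reducibility_type_def f_def by (auto simp: map_eq_Cons_conv mult.assoc)
  have no_root: "poly f1 x \<noteq> 0" "poly f2 x \<noteq> 0" "poly f3 x \<noteq> 0" for x
    using irr deg by (simp_all add: irreducible_imp_no_root)
  then have no_root_f: "poly f x \<noteq> 0" for x by (simp add: f)
  obtain a1 b1 where f1: "f1 = smult (lead_coeff f1) [:b1, a1, 1:]"
    using degree_2_monic_multiple[OF deg(1)] .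
  obtain a2 b2 where f2: "f2 = smult (lead_coeff f2) [:b2, a2, 1:]"
    using degree_2_monic_multiple[OF deg(2)] .
  obtain a3 b3 where f3: "f3 = smult (lead_coeff f3) [:b3, a3, 1:]"
    using degree_2_monic_multiple[OF deg(3)] .
  \<comment> \<open>Since the leading coefficients multiply to 1, the three factors can be replaced
    by their monic associates.\<close>
  have "lead_coeff f1 * lead_coeff f2 * lead_coeff f3 = lead_coeff f"
    unfolding f by (simp add: lead_coeff_mult)
  also have "\<dots> = 1" unfolding f_def trinomial_6_3 by simp
  finally have lc: "lead_coeff f1 * lead_coeff f2 * lead_coeff f3 = 1" .
  have "f = smult (lead_coeff f1 * lead_coeff f2 * lead_coeff f3)
      ([:b1, a1, 1:] * [:b2, a2, 1:] * [:b3, a3, 1:])"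
    unfolding f by (subst f1, subst f2, subst f3)
      (simp only: mult_smult_left mult_smult_right smult_smult mult_ac)
  then have fm: "f = [:b1, a1, 1:] * [:b2, a2, 1:] * [:b3, a3, 1:]" by (simp only: lc smult_1_left)
  have "[:b1, a1, 1:] dvd f" "[:b2, a2, 1:] dvd f" "[:b3, a3, 1:] dvd f"
    unfolding fm by (metis dvd_mult2 dvd_triv_left dvd_triv_right)+
  then have "B = b1 ^ 3" "B = b2 ^ 3" "B = b3 ^ 3"
    using no_root_f unfolding f_def by (auto intro: quadratic_dvd_trinomial)
  then have B: "B = b1 ^ 3" and b: "b2 = b1" "b3 = b1" by (simp_all add: cube_eq_iff)
  have coeffs: "coeff f 5 = 0" "coeff f 4 = 0" "coeff f 3 = A"
    unfolding f_def trinomial_6_3 by (simp_all add: eval_nat_numeral)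
  have a3: "a3 = - a1 - a2"
    using coeffs(1) unfolding fm by (simp add: eval_nat_numeral algebra_simps add_eq_0_iff)
  have b1: "3 * b1 = a1\<^sup>2 + a1 * a2 + a2\<^sup>2"
    using coeffs(2) unfolding fm b a3 by (simp add: eval_nat_numeral algebra_simps)
  \<comment> \<open>With equal constant terms, the mixed terms of the \<open>x^3\<close> coefficient
    sum to \<open>2 b1 (a1 + a2 + a3) = 0\<close>.\<close>
  have A: "A = a1 * a2 * a3"
    using coeffs(3) unfolding fm b a3 by (simp add: eval_nat_numeral algebra_simps)
  with assms(1) have nz: "a1 \<noteq> 0" "a2 \<noteq> 0" "a3 \<noteq> 0" by auto
  \<comment> \<open>Dividing the roots by \<open>c\<close> turns the linear coefficients into
    \<open>3\<close>, \<open>3u\<close> and \<open>-3(u + 1)\<close>; the 3 in \<open>c\<close>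
    removes the denominator from \<open>3 * b1 = a1^2 + a1 a2 + a2^2\<close>.\<close>
  define u c where "u = a2 / a1" and "c = a1 / 3"
  have a: "a1 = 3 * c" "a2 = 3 * c * u" "a3 = - 3 * c * (u + 1)" and "c \<noteq> 0"
    using nz by (simp_all add: u_def c_def a3 field_simps)
  have b1': "b1 = 3 * c\<^sup>2 * (u\<^sup>2 + u + 1)"
    using b1 unfolding a by (simp add: power2_eq_square algebra_simps)
  \<comment> \<open>At this value the first factor would be the square of \<open>x + 3c/2\<close>,
    up to a constant.\<close>
  have "u \<noteq> -1/2"
  proof
    assume "u = -1/2"
    then have "b1 = 9 / 4 * c\<^sup>2" unfolding b1' by (simp add: power2_eq_square)
    then have "poly [:b1, a1, 1:] (- 3 / 2 * c) = 0"
      unfolding a by (simp add: power2_eq_square)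
    then have "poly f1 (- 3 / 2 * c) = 0" by (metis f1 poly_smult mult_zero_right)
    with no_root show False by blast
  qed
  moreover have "u \<noteq> 0" "u \<noteq> -1" using nz a by auto
  moreover have "A = -27 * u * (u + 1) * c ^ 3"
    unfolding A a by (simp add: eval_nat_numeral)
  moreover have "B = 27 * (u\<^sup>2 + u + 1) ^ 3 * c ^ 6"
    unfolding B b1' by (simp add: power_mult_distrib flip: power_mult)
  ultimately show thesis using that \<open>c \<noteq> 0\<close> by blast
qed

lemma type_1_1_2_2:
  assumes "A \<noteq> 0" "B \<noteq> 0" "has_reducibility_type (trinomial 6 3 A B) [1, 1, 2, 2]"
  obtains u c where "u \<noteq> 0" "u \<noteq> -1" "c \<noteq> 0" "A = (- (u ^ 3) - 1) * c ^ 3" "B = u ^ 3 * c ^ 6"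
proof -
  from assms(3) obtain f1 f2 f3 f4 where f: "trinomial 6 3 A B = f1 * (f2 * (f3 * f4))"
    and deg: "degree f1 = 1" "degree f2 = 1"
    unfolding has_reducibility_type_def by (auto simp: map_eq_Cons_conv)
  obtain \<alpha> \<beta> k where *: "\<alpha> \<noteq> 0" "\<beta> \<noteq> 0" "k \<noteq> 0"
    "A = - (\<alpha> ^ 3 + \<beta> ^ 3)" "B = \<alpha> ^ 3 * \<beta> ^ 3"
    "[:\<alpha>\<^sup>2, \<alpha>, 1:] * [:\<beta>\<^sup>2, \<beta>, 1:] = smult k (f3 * f4)"
    using trinomial_two_linear_factors[OF f deg assms(2)] .
  \<comment> \<open>Opposite roots would have opposite cubes and make \<open>A\<close> vanish.
    Scaling by \<open>c = \<alpha>\<close> then moves the roots to 1 and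
    \<open>u = \<beta> / \<alpha>\<close>.\<close>
  have "\<alpha> + \<beta> \<noteq> 0"
  proof
    assume "\<alpha> + \<beta> = 0"
    then have "\<beta> = - \<alpha>" by (simp add: eq_neg_iff_add_eq_0 add.commute)
    then show False using *(4) assms(1) by simp
  qed
  then have "\<beta> / \<alpha> \<noteq> -1" using *(1) by (auto simp: field_simps)
  moreover have "A = (- ((\<beta> / \<alpha>) ^ 3) - 1) * \<alpha> ^ 3" "B = (\<beta> / \<alpha>) ^ 3 * \<alpha> ^ 6"
    unfolding *(4,5) using *(1) by (simp_all add: field_simps eval_nat_numeral)
  moreover have "\<beta> / \<alpha> \<noteq> 0" using *(1,2) by simp
  ultimately show thesis using that *(1) by blast
qed

text \<open>After two linear factors are removed, a product of two definite quadratics remains,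
  which leaves no root for a third linear factor.\<close>

lemma not_type_1_1_1_1_2:
  assumes "B \<noteq> 0"
  shows "\<not> has_reducibility_type (trinomial 6 3 A B) [1, 1, 1, 1, 2]"
proof
  assume "has_reducibility_type (trinomial 6 3 A B) [1, 1, 1, 1, 2]"
  then obtain f1 f2 f3 h where f: "trinomial 6 3 A B = f1 * (f2 * (f3 * h))"
    and deg: "degree f1 = 1" "degree f2 = 1" "degree f3 = 1"
    unfolding has_reducibility_type_def by (auto simp: map_eq_Cons_conv)
  obtain \<alpha> \<beta> k where *: "\<alpha> \<noteq> 0" "\<beta> \<noteq> 0" "[:\<alpha>\<^sup>2, \<alpha>, 1:] * [:\<beta>\<^sup>2, \<beta>, 1:] = smult k (f3 * h)"
    using trinomial_two_linear_factors[OF f deg(1,2) assms] .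
  obtain \<delta> l where "f3 = smult l [:- \<delta>, 1:]"
    using degree_1_root[OF deg(3)] .
  then have "poly ([:\<alpha>\<^sup>2, \<alpha>, 1:] * [:\<beta>\<^sup>2, \<beta>, 1:]) \<delta> = 0"
    unfolding *(3) by simp
  moreover have "poly ([:\<alpha>\<^sup>2, \<alpha>, 1:] * [:\<beta>\<^sup>2, \<beta>, 1:]) \<delta>
      = (\<delta>\<^sup>2 + \<delta> * \<alpha> + \<alpha>\<^sup>2) * (\<delta>\<^sup>2 + \<delta> * \<beta> + \<beta>\<^sup>2)"
    by (simp add: power2_eq_square algebra_simps)
  ultimately show False using * by (simp add: sum_squares_mixed_eq_0_iff)
qed

lemma type_1_2_3:
  assumes "B \<noteq> 0" "has_reducibility_type (trinomial 6 3 A B) [1, 2, 3]"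
  obtains t c where "\<nexists>r. t = r ^ 3" "c \<noteq> 0" "A = (t - 1) * c ^ 3" "B = - t * c ^ 6"
proof -
  from assms(2) obtain f1 f2 f3 where f: "trinomial 6 3 A B = f1 * (f2 * f3)"
    and deg: "degree f1 = 1" "degree f2 = 2" "degree f3 = 3"
    and irr: "irreducible f2" "irreducible f3"
    unfolding has_reducibility_type_def by (auto simp: map_eq_Cons_conv)
  obtain \<alpha> \<gamma> k where *: "\<alpha> \<noteq> 0" "k \<noteq> 0" "A = - (\<alpha> ^ 3 + \<gamma>)" "B = \<alpha> ^ 3 * \<gamma>"
    "[:\<alpha>\<^sup>2, \<alpha>, 1:] * [:- \<gamma>, 0, 0, 1:] = smult k (f2 * f3)"
    using trinomial_linear_factor[OF f deg(1) assms(1)] .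
  \<comment> \<open>Here \<open>t = -\<gamma> / \<alpha>^3\<close> and \<open>c = \<alpha>\<close>.
    If \<open>t\<close> were a cube, \<open>\<gamma>\<close> would have a rational cube root, which
    would be a root of one of the irreducible factors \<open>f2\<close>, \<open>f3\<close> of degree
    2 and 3.\<close>
  have "- \<gamma> / \<alpha> ^ 3 \<noteq> r ^ 3" for r
  proof
    assume "- \<gamma> / \<alpha> ^ 3 = r ^ 3"
    then have "\<gamma> = (- r * \<alpha>) ^ 3"
      using *(1) by (simp add: field_simps power_mult_distrib minus_equation_iff[of \<gamma>])
    then have "poly [:- \<gamma>, 0, 0, 1:] (- r * \<alpha>) = 0"
      by (simp add: eval_nat_numeral)
    then have "poly ([:\<alpha>\<^sup>2, \<alpha>, 1:] * [:- \<gamma>, 0, 0, 1:]) (- r * \<alpha>) = 0"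
      by (simp only: poly_mult mult_zero_right)
    then have "poly f2 (- r * \<alpha>) = 0 \<or> poly f3 (- r * \<alpha>) = 0"
      unfolding *(5) using *(2) by simp
    with irreducible_imp_no_root[OF irr(1)] irreducible_imp_no_root[OF irr(2)] deg
    show False by simp
  qed
  moreover have "A = (- \<gamma> / \<alpha> ^ 3 - 1) * \<alpha> ^ 3" "B = - (- \<gamma> / \<alpha> ^ 3) * \<alpha> ^ 6"
    unfolding *(3,4) using *(1) by (simp_all add: field_simps eval_nat_numeral)
  ultimately show thesis using that *(1) by blast
qed

theorem theorem4p4:
  fixes A B :: rat
  assumes "A * B \<noteq> 0"
  shows
    "(has_reducibility_type (trinomial 6 3 A B) [2, 2, 2] \<longrightarrow>
       (\<exists>u::rat. u \<noteq> 0 \<and> u \<noteq> -1 \<and> u \<noteq> -1/2 \<and>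
          equal_up_to_scaling 6 3 (A, B) (-27 * u * (u + 1), 27 * (u^2 + u + 1)^3) \<and>
          trinomial 6 3 (-27 * u * (u + 1)) (27 * (u^2 + u + 1)^3) =
            [:3 * (u^2 + u + 1), 3, 1:] *
            [:3 * (u^2 + u + 1), -3 * (u + 1), 1:] *
            [:3 * (u^2 + u + 1), 3 * u, 1:])) \<and>
     (has_reducibility_type (trinomial 6 3 A B) [1, 1, 2, 2] \<longrightarrow>
       (\<exists>u::rat. u \<noteq> 0 \<and> u \<noteq> -1 \<and>
          equal_up_to_scaling 6 3 (A, B) (-(u^3) - 1, u^3) \<and>
          trinomial 6 3 (-(u^3) - 1) (u^3) =
            [:-1, 1:] * [:-u, 1:] * [:1, 1, 1:] * [:u^2, u, 1:])) \<and>
     \<not> has_reducibility_type (trinomial 6 3 A B) [1, 1, 1, 1, 2] \<and>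
     (has_reducibility_type (trinomial 6 3 A B) [1, 2, 3] \<longrightarrow>
       (\<exists>t::rat. (\<nexists>r::rat. t = r^3) \<and>
          equal_up_to_scaling 6 3 (A, B) (t - 1, -t) \<and>
          trinomial 6 3 (t - 1) (-t) =
            [:-1, 1:] * [:1, 1, 1:] * [:t, 0, 0, 1:]))"
proof -
  from assms have A: "A \<noteq> 0" and B: "B \<noteq> 0" by auto
  show ?thesis
  proof (intro conjI impI)
    assume "has_reducibility_type (trinomial 6 3 A B) [2, 2, 2]"
    with A obtain u c where "u \<noteq> 0" "u \<noteq> -1" "u \<noteq> -1/2" "c \<noteq> 0"
      "A = -27 * u * (u + 1) * c ^ 3" "B = 27 * (u\<^sup>2 + u + 1) ^ 3 * c ^ 6"
      by (rule type_2_2_2)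
    \<comment> \<open>The displayed factorization is a polynomial identity in \<open>u\<close>;
      \<open>A\<close> and \<open>B\<close> enter only through the scaling by
      \<open>c\<close>.\<close>
    moreover have "trinomial 6 3 (-27 * u * (u + 1)) (27 * (u^2 + u + 1)^3) =
        [:3 * (u^2 + u + 1), 3, 1:] *
        [:3 * (u^2 + u + 1), -3 * (u + 1), 1:] *
        [:3 * (u^2 + u + 1), 3 * u, 1:]"
      unfolding trinomial_6_3 by (simp add: eval_nat_numeral algebra_simps)
    ultimately show "\<exists>u::rat. u \<noteq> 0 \<and> u \<noteq> -1 \<and> u \<noteq> -1/2 \<and>
        equal_up_to_scaling 6 3 (A, B) (-27 * u * (u + 1), 27 * (u^2 + u + 1)^3) \<and>
        trinomial 6 3 (-27 * u * (u + 1)) (27 * (u^2 + u + 1)^3) =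
          [:3 * (u^2 + u + 1), 3, 1:] *
          [:3 * (u^2 + u + 1), -3 * (u + 1), 1:] *
          [:3 * (u^2 + u + 1), 3 * u, 1:]"
      by (intro exI[of _ u]) auto
  next
    assume "has_reducibility_type (trinomial 6 3 A B) [1, 1, 2, 2]"
    with A B obtain u c where "u \<noteq> 0" "u \<noteq> -1" "c \<noteq> 0"
      "A = (- (u ^ 3) - 1) * c ^ 3" "B = u ^ 3 * c ^ 6"
      by (rule type_1_1_2_2)
    moreover have "trinomial 6 3 (-(u^3) - 1) (u^3) =
        [:-1, 1:] * [:-u, 1:] * [:1, 1, 1:] * [:u^2, u, 1:]"
      unfolding trinomial_6_3 by (simp add: eval_nat_numeral algebra_simps)
    ultimately show "\<exists>u::rat. u \<noteq> 0 \<and> u \<noteq> -1 \<and>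
        equal_up_to_scaling 6 3 (A, B) (-(u^3) - 1, u^3) \<and>
        trinomial 6 3 (-(u^3) - 1) (u^3) =
          [:-1, 1:] * [:-u, 1:] * [:1, 1, 1:] * [:u^2, u, 1:]"
      by (intro exI[of _ u]) auto
  next
    show "\<not> has_reducibility_type (trinomial 6 3 A B) [1, 1, 1, 1, 2]"
      using B by (rule not_type_1_1_1_1_2)
  next
    assume "has_reducibility_type (trinomial 6 3 A B) [1, 2, 3]"
    with B obtain t c where "\<nexists>r. t = r ^ 3" "c \<noteq> 0" "A = (t - 1) * c ^ 3" "B = - t * c ^ 6"
      by (rule type_1_2_3)
    moreover have "trinomial 6 3 (t - 1) (-t) = [:-1, 1:] * [:1, 1, 1:] * [:t, 0, 0, 1:]"
      unfolding trinomial_6_3 by (simp add: eval_nat_numeral algebra_simps)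
    ultimately show "\<exists>t::rat. (\<nexists>r::rat. t = r^3) \<and>
        equal_up_to_scaling 6 3 (A, B) (t - 1, -t) \<and>
        trinomial 6 3 (t - 1) (-t) = [:-1, 1:] * [:1, 1, 1:] * [:t, 0, 0, 1:]"
      by (intro exI[of _ t]) auto
  qed
qed

end
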